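(* Let $F$ be a fullerene with $n\equiv 2\pmod 6$ vertices. Then $c(F)\neq\lfloor n/6\rfloor-2$.
   Context: A fullerene is a finite, trivalent plane graph all of whose faces are pentagons and hexagons. For a perfect matching of $F$, a face is alternating if exactly half of its boundary edges lie in the matching. A resonant pattern is a set of pairwise vertex-disjoint faces all alternating with respect to one common perfect matching. The Clar number $c(F)$ is the maximum size of a resonant pattern of $F$. *)

theory Defs
  imports
    Complex_Main
    "HOL-Combinatorics.Orbits"
    "Graph_Theory.Digraph_Component"
    "Graph_Theory.Bidirected_Digraph"
begin

text \<open>
  A plane graph is given as a combinatorial map of genus zero on a symmetric digraph \<open>G\<close>: the
  involution \<open>arev\<close> sends an arc to its reversal, and the permutation \<open>rot\<close> sends an arc to the
  next arc, in clockwise order, with the same tail. Two reversed arcs form one undirected edge.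
\<close>

definition edge_of :: "('e \<Rightarrow> 'e) \<Rightarrow> 'e \<Rightarrow> 'e set" where
  "edge_of arev a = {a, arev a}"

definition edges :: "('v, 'e) pre_digraph \<Rightarrow> ('e \<Rightarrow> 'e) \<Rightarrow> 'e set set" where
  "edges G arev = edge_of arev ` arcs G"

definition incident :: "('v, 'e) pre_digraph \<Rightarrow> 'v \<Rightarrow> 'e set \<Rightarrow> bool" where
  "incident G v e \<longleftrightarrow> v \<in> tail G ` e"

text \<open>
  A face is represented by the set of arcs traversed when walking along its boundary with the
  face always on the same side: after \<open>a\<close>, continue with the arc following \<open>arev a\<close> around the
  head of \<open>a\<close>. The unbounded face is one of the faces.
\<close>

definition faces :: "('v, 'e) pre_digraph \<Rightarrow> ('e \<Rightarrow> 'e) \<Rightarrow> ('e \<Rightarrow> 'e) \<Rightarrow> 'e set set" where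
  "faces G arev rot = orbit (rot \<circ> arev) ` arcs G"

definition face_verts :: "('v, 'e) pre_digraph \<Rightarrow> 'e set \<Rightarrow> 'v set" where
  "face_verts G f = tail G ` f"

definition face_edges :: "('e \<Rightarrow> 'e) \<Rightarrow> 'e set \<Rightarrow> 'e set set" where
  "face_edges arev f = edge_of arev ` f"

text \<open>
  Connectedness is no restriction for fullerenes, since every face of a disconnected plane graph
  that meets two components has a disconnected boundary and so is not a polygon. For connected
  maps, genus zero is Euler's formula.
\<close>

locale plane_graph = graph G + bidirected_digraph G arev
  for G :: "('v, 'e) pre_digraph" and arev :: "'e \<Rightarrow> 'e" +
  fixes rot :: "'e \<Rightarrow> 'e"
  assumes rot_permutes: "rot permutes arcs G"
    and rot_cyclic: "\<And>v. v \<in> verts G \<Longrightarrow> out_arcs G v \<noteq> {} \<Longrightarrow> cyclic_on rot (out_arcs G v)"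
    and connected: "Digraph_Component.connected G"
    and genus_zero:
      "int (card (verts G)) - int (card (edges G arev)) + int (card (faces G arev rot)) = 2"

text \<open>The injectivity condition says that the boundary walk is a cycle of length \<open>k\<close>.\<close>

definition polygonal_face :: "('v, 'e) pre_digraph \<Rightarrow> nat \<Rightarrow> 'e set \<Rightarrow> bool" where
  "polygonal_face G k f \<longleftrightarrow> card f = k \<and> inj_on (tail G) f"

locale fullerene = plane_graph G arev rot
  for G :: "('v, 'e) pre_digraph" and arev rot :: "'e \<Rightarrow> 'e" +
  assumes trivalent: "\<And>v. v \<in> verts G \<Longrightarrow> out_degree G v = 3"
    and pentagon_or_hexagon:
      "\<And>f. f \<in> faces G arev rot \<Longrightarrow> polygonal_face G 5 f \<or> polygonal_face G 6 f"

definition perfect_matching :: "('v, 'e) pre_digraph \<Rightarrow> ('e \<Rightarrow> 'e) \<Rightarrow> 'e set set \<Rightarrow> bool" where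
  "perfect_matching G arev M \<longleftrightarrow>
     M \<subseteq> edges G arev \<and> (\<forall>v\<in>verts G. \<exists>!e. e \<in> M \<and> incident G v e)"

definition alternating :: "('e \<Rightarrow> 'e) \<Rightarrow> 'e set set \<Rightarrow> 'e set \<Rightarrow> bool" where
  "alternating arev M f \<longleftrightarrow> 2 * card (face_edges arev f \<inter> M) = card (face_edges arev f)"

definition resonant_pattern ::
  "('v, 'e) pre_digraph \<Rightarrow> ('e \<Rightarrow> 'e) \<Rightarrow> ('e \<Rightarrow> 'e) \<Rightarrow> 'e set set \<Rightarrow> bool" where
  "resonant_pattern G arev rot R \<longleftrightarrow>
     R \<subseteq> faces G arev rot \<and>
     (\<forall>f\<in>R. \<forall>g\<in>R. f \<noteq> g \<longrightarrow> face_verts G f \<inter> face_verts G g = {}) \<and>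
     (\<exists>M. perfect_matching G arev M \<and> (\<forall>f\<in>R. alternating arev M f))"

text \<open>
  For finite \<open>G\<close> the sizes form a finite set of naturals, whose \<open>Sup\<close> is its maximum. The set
  is nonempty as soon as \<open>G\<close> has a perfect matching, as every fullerene does by Petersen's
  theorem; \<open>Sup\<close> of the empty set would be \<open>0\<close>.
\<close>

definition clar_number :: "('v, 'e) pre_digraph \<Rightarrow> ('e \<Rightarrow> 'e) \<Rightarrow> ('e \<Rightarrow> 'e) \<Rightarrow> nat" where
  "clar_number G arev rot = Sup {card R | R. resonant_pattern G arev rot R}"

end

theory Submission
  imports Defs
begin

text \<open>
  Let \<open>R\<close> be a resonant pattern of \<open>h\<close> hexagons with perfect matching \<open>M\<close>, and suppose that the
  graph has \<open>6 * h + 14\<close> vertices. Call an edge free if it lies neither in \<open>M\<close> nor on a face of \<open>R\<close>.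
  On a face outside \<open>R\<close>, no two consecutive edges are both not free, so such a face has at least
  \<open>3\<close> free edges. Counting with Euler's formula, there are \<open>2 * h + 9\<close> faces outside \<open>R\<close>, with
  \<open>6 * h + 28\<close> incidences with free edges, so exactly one of them has \<open>4\<close> free edges and all others
  have \<open>3\<close>.

  As the complement of \<open>M\<close> has even degree everywhere and the map is planar, the faces can be
  coloured with two colours that differ exactly across the edges outside \<open>M\<close>. Every free edge
  then has one side of each colour, so the two colour classes have the same number of incidences
  with free edges. But modulo \<open>3\<close> these numbers are \<open>0\<close> and \<open>1\<close>.
\<close>

section \<open>Even edge sets are cuts of the dual of a plane graph\<close>

text \<open>Cardinality modulo 2 is additive under symmetric difference.\<close>

lemma odd_card_neq:
  assumes "finite A"
  shows "odd (card {a \<in> A. P a \<noteq> Q a}) \<longleftrightarrow> odd (card {a \<in> A. P a}) \<noteq> odd (card {a \<in> A. Q a})"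
  using assms
proof (induction A)
  case (insert x A)
  have ins: "card {a \<in> insert x A. R a} = of_bool (R x) + card {a \<in> A. R a}" for R
  proof -
    have "{a \<in> insert x A. R a} = (if R x then insert x {a \<in> A. R a} else {a \<in> A. R a})"
      by auto
    then show ?thesis
      using insert.hyps by simp
  qed
  show ?case
    unfolding ins using insert.IH by auto
qed simp

context bidirected_digraph
begin

lemma edge_of_arev [simp]: "edge_of arev (arev a) = edge_of arev a"
  by (auto simp: edge_of_def)

lemma edge_of_eq_iff: "edge_of arev a = edge_of arev b \<longleftrightarrow> a = b \<or> a = arev b"
  by (auto simp: edge_of_def doubleton_eq_iff)

lemma incident_edge_of: "a \<in> arcs G \<Longrightarrow> incident G v (edge_of arev a) \<longleftrightarrow> v = tail G a \<or> v = head G a"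
  by (auto simp: incident_def edge_of_def)

lemma arev_image_eq:
  assumes "\<And>a. a \<in> A \<Longrightarrow> arev a \<in> A"
  shows "arev ` A = A"
proof
  show "A \<subseteq> arev ` A"
    using assms by (metis arev_arev image_eqI subsetI)
qed (use assms in blast)

end

section \<open>Parities of edge sets at vertices\<close>

context plane_graph
begin

text \<open>The boundary of \<open>X\<close> over GF(2). As there are no loops, the arcs leaving
  \<open>v\<close> correspond one to one to the edges at \<open>v\<close>.\<close>

definition odd_at :: "'e set set \<Rightarrow> 'v \<Rightarrow> bool" where
  "odd_at X v \<longleftrightarrow> odd (card {a \<in> out_arcs G v. edge_of arev a \<in> X})"

lemma odd_at_empty: "\<not> odd_at {} v"
  by (simp add: odd_at_def)

lemma odd_at_sym_diff: "odd_at (sym_diff X Y) v \<longleftrightarrow> odd_at X v \<noteq> odd_at Y v"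
proof -
  have "{a \<in> out_arcs G v. edge_of arev a \<in> sym_diff X Y} =
      {a \<in> out_arcs G v. (edge_of arev a \<in> X) \<noteq> (edge_of arev a \<in> Y)}"
    by blast
  then show ?thesis
    unfolding odd_at_def by (simp only: odd_card_neq finite_out_arcs)
qed

lemma odd_at_single:
  assumes "a \<in> arcs G"
  shows "odd_at {edge_of arev a} v \<longleftrightarrow> (v = tail G a) \<noteq> (v = head G a)"
proof -
  have "{b \<in> out_arcs G v. edge_of arev b \<in> {edge_of arev a}} =
      (if v = tail G a then {a} else {}) \<union> (if v = head G a then {arev a} else {})"
    using assms by (auto simp: edge_of_eq_iff)
  then show ?thesis
    using assms no_loops[OF assms] by (auto simp: odd_at_def)
qed

lemma strongly_connected_G: "strongly_connected G"
  using symmetric_connected_imp_strongly_connected sym_arcs connected by blast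

text \<open>Add up the edges of a walk from \<open>u\<close> to \<open>v\<close> modulo 2: the
  contributions at interior vertices cancel.\<close>

lemma ex_odd_at_pair:
  assumes "u \<in> verts G" "v \<in> verts G"
  shows "\<exists>X\<subseteq>edges G arev. \<forall>w. odd_at X w \<longleftrightarrow> (w = u) \<noteq> (w = v)"
proof -
  have "u \<rightarrow>\<^sup>*\<^bsub>G\<^esub> v"
    using strongly_connected_G assms by auto
  then show ?thesis
  proof (induction rule: reachable_induct)
    case base
    show ?case
      by (rule exI[of _ "{}"]) (simp add: odd_at_empty)
  next
    case (step x y)
    then obtain X where X: "X \<subseteq> edges G arev" "\<And>w. odd_at X w \<longleftrightarrow> (w = u) \<noteq> (w = x)"
      by blast
    obtain a where a: "a \<in> arcs G" "tail G a = x" "head G a = y"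
      using step by auto
    have "sym_diff X {edge_of arev a} \<subseteq> edges G arev"
      using X(1) a(1) by (auto simp: edges_def)
    moreover have "odd_at (sym_diff X {edge_of arev a}) w \<longleftrightarrow> (w = u) \<noteq> (w = y)" for w
      unfolding odd_at_sym_diff odd_at_single[OF a(1)] X(2) a(2,3) by blast
    ultimately show ?case
      by blast
  qed
qed

text \<open>Add up modulo 2 walks that join \<open>r\<close> to each vertex of \<open>W\<close>. The
  parity at \<open>r\<close> is left open, since the handshake lemma forces it.\<close>

lemma ex_odd_at:
  assumes "r \<in> verts G" "W \<subseteq> verts G"
  shows "\<exists>X\<subseteq>edges G arev. \<forall>w. w \<noteq> r \<longrightarrow> (odd_at X w \<longleftrightarrow> w \<in> W)"
proof -
  have "finite W"
    using assms(2) finite_verts by (rule finite_subset)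
  then show ?thesis
    using assms(2)
  proof (induction W)
    case empty
    show ?case
      by (rule exI[of _ "{}"]) (simp add: odd_at_empty)
  next
    case (insert v W)
    then obtain X where X: "X \<subseteq> edges G arev" "\<And>w. w \<noteq> r \<Longrightarrow> odd_at X w \<longleftrightarrow> w \<in> W"
      by blast
    obtain Y where Y: "Y \<subseteq> edges G arev" "\<And>w. odd_at Y w \<longleftrightarrow> (w = r) \<noteq> (w = v)"
      using ex_odd_at_pair[of r v] assms insert.prems by blast
    have "sym_diff X Y \<subseteq> edges G arev"
      using X(1) Y(1) by blast
    moreover have "odd_at (sym_diff X Y) w \<longleftrightarrow> w \<in> insert v W" if "w \<noteq> r" for w
      unfolding odd_at_sym_diff X(2)[OF that] Y(2) using that insert.hyps by blast
    ultimately show ?case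
      by blast
  qed
qed

lemma finite_edges: "finite (edges G arev)"
  by (simp add: edges_def)

lemma finite_faces: "finite (faces G arev rot)"
  by (simp add: faces_def)

text \<open>The cycle space of the graph over GF(2).\<close>

definition even_sets :: "'e set set set" where
  "even_sets = {X. X \<subseteq> edges G arev \<and> (\<forall>v\<in>verts G. \<not> odd_at X v)}"

lemma finite_even_sets: "finite even_sets"
  by (rule finite_subset[of _ "Pow (edges G arev)"]) (auto simp: even_sets_def finite_edges)

text \<open>The sets \<open>J W\<close> with \<open>W\<close> avoiding \<open>r\<close> have
  distinct parities, so they translate the cycle space to disjoint families of edge sets. This
  bounds its dimension by \<open>E - V + 1\<close>.\<close>

lemma card_even_sets_le:
  "card even_sets * 2 ^ (card (verts G) - 1) \<le> 2 ^ card (edges G arev)"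
proof -
  obtain r where r: "r \<in> verts G"
    using strongly_connected_G by (auto simp: strongly_connected_def)
  obtain J where J: "\<And>W. W \<subseteq> verts G \<Longrightarrow> J W \<subseteq> edges G arev"
      "\<And>W w. \<lbrakk>W \<subseteq> verts G; w \<noteq> r\<rbrakk> \<Longrightarrow> odd_at (J W) w \<longleftrightarrow> w \<in> W"
    using ex_odd_at[OF r] by metis
  let ?g = "\<lambda>(X, W). sym_diff X (J W)"
  let ?D = "even_sets \<times> Pow (verts G - {r})"
  \<comment> \<open>Adding an even set changes no parity, so \<open>W\<close> can be read off from
    the sum.\<close>
  have rec: "w \<in> W \<longleftrightarrow> w \<in> verts G \<and> w \<noteq> r \<and> odd_at (sym_diff X (J W)) w"
    if "X \<in> even_sets" "W \<subseteq> verts G - {r}" for X W w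
    using that J(2)[of W w] unfolding odd_at_sym_diff even_sets_def by blast
  have "inj_on ?g ?D"
  proof (rule inj_onI, clarify)
    fix X W X' W'
    assume D: "X \<in> even_sets" "X' \<in> even_sets" "W \<subseteq> verts G - {r}" "W' \<subseteq> verts G - {r}"
      and eq: "sym_diff X (J W) = sym_diff X' (J W')"
    have "W = W'"
      using rec[OF D(1,3)] rec[OF D(2,4)] unfolding eq by blast
    with eq show "X = X' \<and> W = W'"
      by blast
  qed
  moreover have "?g ` ?D \<subseteq> Pow (edges G arev)"
  proof clarify
    fix X W e
    assume "X \<in> even_sets" "W \<subseteq> verts G - {r}" "e \<in> sym_diff X (J W)"
    then show "e \<in> edges G arev"
      using J(1)[of W] by (auto simp: even_sets_def)
  qed
  ultimately have "card ?D \<le> card (Pow (edges G arev))"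
    using card_inj_on_le finite_edges by blast
  then show ?thesis
    using r by (simp add: card_cartesian_product card_Pow finite_edges)
qed

section \<open>Faces as orbits, and the cuts given by sets of faces\<close>

lemma next_arc_permutes: "(rot \<circ> arev) permutes arcs G"
  by (intro permutes_compose arev_permutes_arcs rot_permutes)

lemma permutation_next_arc: "permutation (rot \<circ> arev)"
  using next_arc_permutes finite_arcs permutation_permutes by blast

lemma self_in_face: "a \<in> orbit (rot \<circ> arev) a"
  by (intro permutation_self_in_orbit permutation_next_arc)

text \<open>\<open>rot a\<close> follows \<open>arev a\<close> on its face. So the face across
  \<open>a\<close> is the face of the next arc around the same tail.\<close>

lemma face_of_rot: "orbit (rot \<circ> arev) (rot a) = orbit (rot \<circ> arev) (arev a)"
  using permutation_orbit_step[OF permutation_next_arc, of "arev a"] by simp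

lemma face_eq_orbit: "\<lbrakk>f \<in> faces G arev rot; a \<in> f\<rbrakk> \<Longrightarrow> orbit (rot \<circ> arev) a = f"
  unfolding faces_def
  using orbit_cyclic_eq3[OF cyclic_on_orbit'[OF permutation_next_arc]] by blast

lemma face_subset_arcs: "f \<in> faces G arev rot \<Longrightarrow> f \<subseteq> arcs G"
  using permutes_orbit_subset[OF next_arc_permutes] unfolding faces_def by blast

lemma rot_in_arcs [simp]: "a \<in> arcs G \<Longrightarrow> rot a \<in> arcs G"
  using rot_permutes by (simp add: permutes_in_image)

lemma cyclic_on_out_arcs: "a \<in> arcs G \<Longrightarrow> cyclic_on rot (out_arcs G (tail G a))"
  by (rule rot_cyclic) auto

lemma tail_rot [simp]: "a \<in> arcs G \<Longrightarrow> tail G (rot a) = tail G a"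
  using cyclic_on_inI[OF cyclic_on_out_arcs, of a a] by auto

lemma next_in_face: "\<lbrakk>f \<in> faces G arev rot; a \<in> f\<rbrakk> \<Longrightarrow> rot (arev a) \<in> f"
  using face_eq_orbit[of f a] orbit.base[of "rot \<circ> arev" a] by auto

text \<open>The cut of the dual graph given by \<open>S\<close>: the orbits of \<open>a\<close> and
  \<open>arev a\<close> are the two sides of an edge.\<close>

definition separating_edges :: "'e set set \<Rightarrow> 'e set set" where
  "separating_edges S = edge_of arev `
    {a \<in> arcs G. (orbit (rot \<circ> arev) a \<in> S) \<noteq> (orbit (rot \<circ> arev) (arev a) \<in> S)}"

lemma edge_in_separating_edges:
  assumes "a \<in> arcs G"
  shows "edge_of arev a \<in> separating_edges S \<longleftrightarrow>
    (orbit (rot \<circ> arev) a \<in> S) \<noteq> (orbit (rot \<circ> arev) (arev a) \<in> S)"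
proof
  assume "edge_of arev a \<in> separating_edges S"
  then obtain b where "edge_of arev a = edge_of arev b"
      "(orbit (rot \<circ> arev) b \<in> S) \<noteq> (orbit (rot \<circ> arev) (arev b) \<in> S)"
    unfolding separating_edges_def by blast
  then show "(orbit (rot \<circ> arev) a \<in> S) \<noteq> (orbit (rot \<circ> arev) (arev a) \<in> S)"
    by (auto simp: edge_of_eq_iff)
qed (use assms in \<open>auto simp: separating_edges_def\<close>)

text \<open>Going once around a vertex, membership in \<open>S\<close> changes an even number of
  times: \<open>rot\<close> permutes the outgoing arcs, so as many have their own face in
  \<open>S\<close> as have the face across in \<open>S\<close>.\<close>

lemma separating_edges_even: "separating_edges S \<in> even_sets"
proof -
  let ?c = "\<lambda>a. orbit (rot \<circ> arev) a \<in> S"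
  have "\<not> odd_at (separating_edges S) v" if "v \<in> verts G" for v
  proof -
    have inj_rot: "inj_on rot A" for A
      using permutes_inj_on[OF rot_permutes] .
    have "rot ` out_arcs G v = out_arcs G v"
      by (intro endo_inj_surj inj_rot) auto
    moreover have "rot ` {a \<in> A. ?c (rot a)} = {a \<in> rot ` A. ?c a}" for A
      by auto
    ultimately have "rot ` {a \<in> out_arcs G v. ?c (rot a)} = {a \<in> out_arcs G v. ?c a}"
      by (simp only:)
    then have "bij_betw rot {a \<in> out_arcs G v. ?c (rot a)} {a \<in> out_arcs G v. ?c a}"
      using inj_rot by (simp add: bij_betw_def)
    then have "card {a \<in> out_arcs G v. ?c (rot a)} = card {a \<in> out_arcs G v. ?c a}"
      by (rule bij_betw_same_card)
    moreover have "{a \<in> out_arcs G v. edge_of arev a \<in> separating_edges S} =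
        {a \<in> out_arcs G v. ?c a \<noteq> ?c (rot a)}"
      unfolding face_of_rot by (intro Collect_cong conj_cong refl edge_in_separating_edges) simp
    ultimately show ?thesis
      unfolding odd_at_def by (simp only: odd_card_neq finite_out_arcs)
  qed
  moreover have "separating_edges S \<subseteq> edges G arev"
    by (auto simp: separating_edges_def edges_def)
  ultimately show ?thesis
    by (simp add: even_sets_def)
qed

text \<open>\<open>rot\<close> reaches every arc at a vertex and \<open>arev\<close> crosses an
  edge, so by connectedness they act transitively on the arcs.\<close>

lemma arc_predicate_constant:
  assumes arev_inv: "\<And>a. a \<in> arcs G \<Longrightarrow> P (arev a) \<longleftrightarrow> P a"
    and rot_inv: "\<And>a. a \<in> arcs G \<Longrightarrow> P (rot a) \<longleftrightarrow> P a"
    and "a \<in> arcs G" "b \<in> arcs G"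
  shows "P b \<longleftrightarrow> P a"
proof -
  have around: "P y \<longleftrightarrow> P x" if "x \<in> arcs G" "y \<in> arcs G" "tail G y = tail G x" for x y
  proof -
    have "y \<in> orbit rot x"
      using that orbit_cyclic_eq3[OF cyclic_on_out_arcs[OF that(1)], of x] by auto
    then have "y \<in> arcs G \<and> (P y \<longleftrightarrow> P x)"
      by induction (use that(1) rot_inv in auto)
    then show ?thesis ..
  qed
  have "tail G a \<rightarrow>\<^sup>*\<^bsub>G\<^esub> tail G b"
    using strongly_connected_G assms(3,4) by auto
  then have "\<forall>c\<in>out_arcs G (tail G b). P c \<longleftrightarrow> P a"
  proof (induction rule: reachable_induct)
    case base
    show ?case
      using around[OF assms(3)] by simp
  next
    case (step x y)
    then obtain d where "d \<in> arcs G" "tail G d = x" "head G d = y"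
      by auto
    with step.IH show ?case
      using around[of "arev d"] arev_inv[of d] by auto
  qed
  then show ?thesis
    using assms(4) by auto
qed

text \<open>A cut determines its colour class up to complement, and excluding \<open>f0\<close>
  selects one of the two. With equal cuts, agreement of the two colourings is invariant under
  \<open>arev\<close> and \<open>rot\<close>, and it holds at \<open>f0\<close>.\<close>

lemma inj_on_separating_edges:
  assumes "f0 \<in> faces G arev rot"
  shows "inj_on separating_edges (Pow (faces G arev rot - {f0}))"
proof (rule inj_onI)
  fix S T
  assume S: "S \<in> Pow (faces G arev rot - {f0})" and T: "T \<in> Pow (faces G arev rot - {f0})"
    and eq: "separating_edges S = separating_edges T"
  define P where "P a \<longleftrightarrow> (orbit (rot \<circ> arev) a \<in> S \<longleftrightarrow> orbit (rot \<circ> arev) a \<in> T)" for a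
  have arev_inv: "P (arev a) \<longleftrightarrow> P a" if "a \<in> arcs G" for a
    using edge_in_separating_edges[OF that, of S] edge_in_separating_edges[OF that, of T] eq
    by (auto simp: P_def)
  have rot_inv: "P (rot a) \<longleftrightarrow> P a" if "a \<in> arcs G" for a
    using arev_inv[OF that] by (simp add: P_def face_of_rot)
  obtain a where a: "a \<in> arcs G" "f0 = orbit (rot \<circ> arev) a"
    using assms by (auto simp: faces_def)
  have "P a"
    using S T a by (auto simp: P_def)
  then have "P b" if "b \<in> arcs G" for b
    using arc_predicate_constant[of P a b] arev_inv rot_inv a(1) that by blast
  then show "S = T"
    using S T by (auto simp: P_def faces_def)
qed

text \<open>
  Counting shows surjectivity: there are \<open>2 ^ (F - 1)\<close> face 2-colourings up to swapping the colours,
  at most \<open>2 ^ (E - V + 1)\<close> even edge sets, and these numbers agree by Euler's formula.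
\<close>

theorem even_set_is_separating:
  assumes "faces G arev rot \<noteq> {}" "X \<in> even_sets"
  obtains S where "separating_edges S = X"
proof -
  let ?F = "faces G arev rot"
  obtain f0 where f0: "f0 \<in> ?F"
    using assms(1) by blast
  have image_sub: "separating_edges ` Pow (?F - {f0}) \<subseteq> even_sets"
    using separating_edges_even by blast
  have card_image: "card (separating_edges ` Pow (?F - {f0})) = 2 ^ (card ?F - 1)"
    using f0 by (simp add: card_image inj_on_separating_edges card_Pow finite_faces)
  \<comment> \<open>Both counts are positive, so the truncated subtractions of 1 are exact.\<close>
  have "card (verts G) \<noteq> 0" "card ?F \<noteq> 0"
    using strongly_connected_G f0 by (auto simp: strongly_connected_def finite_faces)
  then have "card (edges G arev) = (card ?F - 1) + (card (verts G) - 1)"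
    using genus_zero by linarith
  then have "card even_sets * 2 ^ (card (verts G) - 1) \<le> 2 ^ (card ?F - 1) * 2 ^ (card (verts G) - 1)"
    using card_even_sets_le by (simp add: power_add)
  then have "card even_sets \<le> 2 ^ (card ?F - 1)"
    by simp
  then have "separating_edges ` Pow (?F - {f0}) = even_sets"
    using card_image image_sub card_seteq finite_even_sets by metis
  then have "X \<in> separating_edges ` Pow (?F - {f0})"
    using assms(2) by (simp only:)
  then show ?thesis
    by (elim imageE) (rule that, simp)
qed

section \<open>Double counting of arcs over faces and edges\<close>

lemma arc_in_face_iff: "f \<in> faces G arev rot \<Longrightarrow> a \<in> f \<longleftrightarrow> orbit (rot \<circ> arev) a = f"
  using face_eq_orbit[of f a] self_in_face[of a] by auto

lemma faces_disjoint: "\<lbrakk>f \<in> faces G arev rot; g \<in> faces G arev rot; a \<in> f; a \<in> g\<rbrakk> \<Longrightarrow> f = g"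
  using face_eq_orbit[of f a] face_eq_orbit[of g a] by simp

lemma inj_on_next_arc: "inj_on (\<lambda>a. rot (arev a)) A"
  using permutes_inj_on[OF next_arc_permutes] by (simp add: comp_def)

text \<open>The faces partition the arcs, being the orbits of one permutation.\<close>

lemma sum_over_faces:
  fixes h :: "'e \<Rightarrow> 'c::comm_monoid_add"
  assumes "A \<subseteq> arcs G"
  shows "(\<Sum>f\<in>faces G arev rot. sum h (f \<inter> A)) = sum h A"
proof -
  have "(\<Sum>f\<in>faces G arev rot. sum h {a \<in> A. orbit (rot \<circ> arev) a = f}) = sum h A"
    using assms finite_subset[OF assms finite_arcs]
    by (intro sum.group finite_faces) (auto simp: faces_def)
  moreover have "{a \<in> A. orbit (rot \<circ> arev) a = f} = f \<inter> A" if "f \<in> faces G arev rot" for f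
    using arc_in_face_iff[OF that] by blast
  ultimately show ?thesis
    by simp
qed

lemma card_arcs_eq_edges: "card (arcs G) = 2 * card (edges G arev)"
proof -
  have "(\<Sum>e\<in>edges G arev. \<Sum>a\<in>{a \<in> arcs G. edge_of arev a = e}. 1) = (\<Sum>a\<in>arcs G. 1::nat)"
    by (intro sum.group finite_arcs finite_edges) (auto simp: edges_def)
  moreover have "(\<Sum>a\<in>{a \<in> arcs G. edge_of arev a = e}. 1::nat) = 2" if e: "e \<in> edges G arev" for e
  proof -
    obtain b where b: "b \<in> arcs G" "e = edge_of arev b"
      using e by (auto simp: edges_def)
    then have "{a \<in> arcs G. edge_of arev a = e} = {b, arev b}"
      by (auto simp: edge_of_eq_iff)
    then show ?thesis
      using arev_neq[OF b(1)] by simp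
  qed
  ultimately show ?thesis
    by simp
qed

end

section \<open>Arc, vertex and face counts of a fullerene\<close>

context fullerene
begin

text \<open>By trivalence the orbit of \<open>a\<close> under \<open>rot\<close> has three elements;
  a return after one or two steps would leave at most two.\<close>

lemma rot_neq:
  assumes "a \<in> arcs G"
  shows "rot a \<noteq> a" "rot (rot a) \<noteq> a"
proof -
  have orb: "card (orbit rot a) = 3"
    using orbit_cyclic_eq3[OF cyclic_on_out_arcs[OF assms], of a] trivalent[of "tail G a"] assms
    by (simp add: out_degree_def)
  have "(rot ^^ n) a \<noteq> a" if "0 < n" "n < 3" for n
  proof
    assume "(rot ^^ n) a = a"
    then have "orbit rot a = (\<lambda>m. (rot ^^ m) a) ` {..<n}"
      using orbit_altdef_bounded that(1) by fastforce
    then have "card (orbit rot a) \<le> n"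
      using card_image_le[of "{..<n}"] by simp
    then show False
      using orb that(2) by simp
  qed
  from this[of 1] this[of 2] show "rot a \<noteq> a" "rot (rot a) \<noteq> a"
    by (simp_all add: numeral_2_eq_2)
qed

lemma inj_on_tail_face: "f \<in> faces G arev rot \<Longrightarrow> inj_on (tail G) f"
  using pentagon_or_hexagon polygonal_face_def by metis

lemma card_face: "f \<in> faces G arev rot \<Longrightarrow> card f = 5 \<or> card f = 6"
  using pentagon_or_hexagon polygonal_face_def by metis

text \<open>No face borders both sides of an edge: otherwise \<open>arev a\<close> and
  \<open>rot (arev a)\<close>, which share a tail, would both lie on it. Hence the edges of a face
  can be counted by its arcs.\<close>

lemma inj_on_edge_of_face:
  assumes "f \<in> faces G arev rot"
  shows "inj_on (edge_of arev) f"
proof (rule inj_onI)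
  fix a b
  assume "a \<in> f" "b \<in> f" and edge: "edge_of arev a = edge_of arev b"
  have a: "a \<in> arcs G"
    using \<open>a \<in> f\<close> face_subset_arcs assms by blast
  have "arev a \<notin> f"
  proof
    assume "arev a \<in> f"
    then have "rot (arev a) = arev a"
      using a by (intro inj_onD[OF inj_on_tail_face[OF assms]] next_in_face[OF assms \<open>a \<in> f\<close>]) simp_all
    then show False
      using rot_neq(1) a by simp
  qed
  then show "a = b"
    using edge \<open>b \<in> f\<close> by (auto simp: edge_of_eq_iff)
qed

lemma card_arcs_eq_verts: "card (arcs G) = 3 * card (verts G)"
proof -
  have "(\<Sum>v\<in>verts G. \<Sum>a\<in>{a \<in> arcs G. tail G a = v}. 1) = (\<Sum>a\<in>arcs G. 1::nat)"
    by (intro sum.group finite_arcs finite_verts) auto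
  moreover have "(\<Sum>a\<in>{a \<in> arcs G. tail G a = v}. 1::nat) = 3" if "v \<in> verts G" for v
    using trivalent[OF that] by (simp add: out_degree_def out_arcs_def)
  ultimately show ?thesis
    by simp
qed

text \<open>Euler's formula with \<open>2 * E = 3 * V\<close>.\<close>

lemma card_faces: "2 * card (faces G arev rot) = card (verts G) + 4"
  using genus_zero card_arcs_eq_edges card_arcs_eq_verts by linarith

text \<open>Every face has at least five arcs, so \<open>5 * F \<le> 3 * V\<close>, while
  \<open>2 * F = V + 4\<close>. The bound makes the excluded Clar number positive.\<close>

lemma card_verts_ge: "card (verts G) \<ge> 20"
proof -
  have "5 * card (faces G arev rot) = (\<Sum>f\<in>faces G arev rot. 5)"
    by simp
  also have "\<dots> \<le> (\<Sum>f\<in>faces G arev rot. card f)"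
    using card_face by (intro sum_mono) fastforce
  also have "\<dots> = (\<Sum>f\<in>faces G arev rot. card (f \<inter> arcs G))"
    using face_subset_arcs by (intro sum.cong) (auto simp: Int_absorb2)
  also have "\<dots> = card (arcs G)"
    using sum_over_faces[of "arcs G" "\<lambda>_. 1::nat"] by simp
  finally show ?thesis
    using card_arcs_eq_verts card_faces by linarith
qed

end

section \<open>Resonant patterns\<close>

locale resonant_fullerene = fullerene G arev rot
  for G :: "('v, 'e) pre_digraph" and arev rot :: "'e \<Rightarrow> 'e" +
  fixes R :: "'e set set" and M :: "'e set set"
  assumes R_faces: "R \<subseteq> faces G arev rot"
    and R_disjoint: "\<And>f g. \<lbrakk>f \<in> R; g \<in> R; f \<noteq> g\<rbrakk> \<Longrightarrow> face_verts G f \<inter> face_verts G g = {}"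
    and matching: "perfect_matching G arev M"
    and R_alternating: "\<And>f. f \<in> R \<Longrightarrow> alternating arev M f"
begin

section \<open>The matching and the pattern, seen on arcs\<close>

lemma matching_arc_unique:
  assumes "a \<in> arcs G" "b \<in> arcs G" "tail G a = tail G b" "edge_of arev a \<in> M" "edge_of arev b \<in> M"
  shows "a = b"
proof -
  have "\<exists>!e. e \<in> M \<and> incident G (tail G a) e"
    using matching assms(1) by (simp add: perfect_matching_def)
  moreover have "incident G (tail G a) (edge_of arev a)" "incident G (tail G a) (edge_of arev b)"
    using assms(1-3) by (simp_all add: incident_edge_of)
  ultimately have "edge_of arev a = edge_of arev b"
    using assms(4,5) by blast
  then show ?thesis
    using assms(2,3) no_loops[OF assms(2)] by (auto simp: edge_of_eq_iff)
qed

lemma ex_matching_arc: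
  assumes "v \<in> verts G"
  obtains a where "a \<in> arcs G" "tail G a = v" "edge_of arev a \<in> M"
proof -
  obtain e where e: "e \<in> M" "incident G v e"
    using matching assms by (auto simp: perfect_matching_def)
  then obtain b where b: "b \<in> arcs G" "e = edge_of arev b"
    using matching by (auto simp: perfect_matching_def edges_def)
  then consider "v = tail G b" | "v = tail G (arev b)"
    using e(2) by (auto simp: incident_edge_of)
  then show ?thesis
  proof cases
    case 1
    then show ?thesis
      using that[of b] b e by simp
  next
    case 2
    then show ?thesis
      using that[of "arev b"] b e by simp
  qed
qed

text \<open>An arc is an edge together with one of its sides, so counting arcs of a face counts
  incidences of edges with that face.\<close>

definition matched_arcs :: "'e set" where
  "matched_arcs = {a \<in> arcs G. edge_of arev a \<in> M}"

definition pattern_arcs :: "'e set" where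
  "pattern_arcs = \<Union>R"

text \<open>\<open>pattern_arcs\<close> holds only the arcs directed along their pattern face, so an
  edge lies off the pattern when neither of its arcs is in it.\<close>

definition free_arcs :: "'e set" where
  "free_arcs = {a \<in> arcs G. a \<notin> pattern_arcs \<and> arev a \<notin> pattern_arcs \<and> a \<notin> matched_arcs}"

lemma arev_matched: "arev a \<in> matched_arcs \<longleftrightarrow> a \<in> matched_arcs"
  unfolding matched_arcs_def using arev_in_arcs[of a] arev_in_arcs[of "arev a"]
  by (simp only: mem_Collect_eq edge_of_arev arev_arev) blast

lemma matched_unique: "\<lbrakk>a \<in> matched_arcs; b \<in> matched_arcs; tail G a = tail G b\<rbrakk> \<Longrightarrow> a = b"
  using matching_arc_unique[of a b] by (simp add: matched_arcs_def)

lemma card_matched_arcs: "card matched_arcs = card (verts G)"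
proof (rule bij_betw_same_card[of "tail G"])
  show "bij_betw (tail G) matched_arcs (verts G)"
  proof (rule bij_betw_imageI)
    show "inj_on (tail G) matched_arcs"
      using matched_unique by (auto intro: inj_onI)
    show "tail G ` matched_arcs = verts G"
    proof
      show "verts G \<subseteq> tail G ` matched_arcs"
        by (rule subsetI, elim ex_matching_arc) (auto simp: matched_arcs_def)
    qed (auto simp: matched_arcs_def)
  qed
qed

text \<open>Consecutive boundary edges meet at the head of \<open>a\<close>, where only one edge is
  matched.\<close>

lemma next_not_matched:
  assumes "a \<in> matched_arcs"
  shows "rot (arev a) \<notin> matched_arcs"
proof
  have a: "a \<in> arcs G"
    using assms by (simp add: matched_arcs_def)
  assume "rot (arev a) \<in> matched_arcs"
  then have "rot (arev a) = arev a"
    using assms a by (intro matched_unique) (auto simp: arev_matched)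
  then show False
    using rot_neq(1) a by simp
qed

text \<open>An alternating face has an even number of edges, which excludes pentagons.\<close>

lemma pattern_face:
  assumes "f \<in> R"
  shows "card f = 6" "card (f \<inter> matched_arcs) = 3"
proof -
  have f: "f \<in> faces G arev rot"
    using assms R_faces by blast
  note inj = inj_on_edge_of_face[OF f]
  have "face_edges arev f \<inter> M = edge_of arev ` (f \<inter> matched_arcs)"
    using face_subset_arcs[OF f] by (auto simp: face_edges_def matched_arcs_def)
  then have "card (face_edges arev f \<inter> M) = card (f \<inter> matched_arcs)"
    using inj by (simp add: card_image inj_on_subset)
  moreover have "card (face_edges arev f) = card f"
    using inj by (simp add: face_edges_def card_image)
  ultimately have "2 * card (f \<inter> matched_arcs) = card f"
    using R_alternating[OF assms] by (simp add: alternating_def)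
  moreover from this show "card f = 6"
    using card_face[OF f] by presburger
  ultimately show "card (f \<inter> matched_arcs) = 3"
    by simp
qed

lemma finite_face: "f \<in> faces G arev rot \<Longrightarrow> finite f"
  using face_subset_arcs finite_arcs by (rule finite_subset)

text \<open>
  Of the six arcs of the face, three are matched, and their successors are three further arcs.
\<close>

lemma pattern_face_cover:
  assumes "f \<in> R" "a \<in> f" "a \<notin> matched_arcs"
  obtains c where "c \<in> f" "c \<in> matched_arcs" "rot (arev c) = a"
proof -
  have f: "f \<in> faces G arev rot"
    using assms R_faces by blast
  let ?B = "f \<inter> matched_arcs"
  let ?C = "(\<lambda>a. rot (arev a)) ` ?B"
  have "?B \<inter> ?C = {}"
    using next_not_matched by blast
  moreover have sub: "?B \<union> ?C \<subseteq> f"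
    using next_in_face[OF f] by blast
  moreover have "card ?C = 3"
    using pattern_face[OF assms(1)] by (simp add: card_image inj_on_next_arc)
  ultimately have "card (?B \<union> ?C) = card f"
    using pattern_face[OF assms(1)] finite_face[OF f] by (simp add: card_Un_disjoint)
  then have "?B \<union> ?C = f"
    using sub finite_face[OF f] card_subset_eq by blast
  then show ?thesis
    using assms(2,3) that by blast
qed

lemma pattern_subset_arcs: "pattern_arcs \<subseteq> arcs G"
  unfolding pattern_arcs_def using R_faces face_subset_arcs by blast

text \<open>A pattern face alternates, so one of its two edges at a vertex is matched; by uniqueness
  it is the matched edge there.\<close>

lemma matched_at_pattern:
  assumes "a \<in> pattern_arcs" "b \<in> matched_arcs" "tail G a = tail G b"
  shows "b \<in> pattern_arcs \<or> arev b \<in> pattern_arcs"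
proof -
  obtain f where f: "f \<in> R" "a \<in> f"
    using assms(1) by (auto simp: pattern_arcs_def)
  show ?thesis
  proof (cases "a \<in> matched_arcs")
    case True
    then show ?thesis
      using matched_unique assms by blast
  next
    case False
    then obtain c where c: "c \<in> f" "c \<in> matched_arcs" "rot (arev c) = a"
      using pattern_face_cover f by blast
    have "c \<in> arcs G"
      using c(2) by (simp add: matched_arcs_def)
    then have "tail G (arev c) = tail G b"
      using c(3) assms(3) tail_rot[of "arev c"] arev_in_arcs[of c] by simp
    then have "arev c = b"
      using matched_unique c(2) assms(2) by (simp add: arev_matched)
    then show ?thesis
      using f(1) c(1) by (auto simp: pattern_arcs_def)
  qed
qed

text \<open>Distinct pattern faces are vertex-disjoint, and a single face passes each vertex at most
  once.\<close>

lemma pattern_unique: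
  assumes "a \<in> pattern_arcs" "b \<in> pattern_arcs" "tail G a = tail G b"
  shows "a = b"
proof -
  obtain f g where fg: "f \<in> R" "g \<in> R" "a \<in> f" "b \<in> g"
    using assms by (auto simp: pattern_arcs_def)
  have "tail G a \<in> face_verts G f" "tail G a \<in> face_verts G g"
    unfolding face_verts_def using fg(3,4) assms(3) by (metis imageI)+
  then have "f = g"
    using R_disjoint[OF fg(1,2)] by blast
  then show ?thesis
    using inj_on_tail_face[of f] R_faces fg assms(3) by (auto dest: inj_onD)
qed

lemma next_in_pattern: "a \<in> pattern_arcs \<Longrightarrow> rot (arev a) \<in> pattern_arcs"
  using R_faces next_in_face by (auto simp: pattern_arcs_def)

text \<open>Pattern faces on both sides of an edge would make \<open>a\<close> and
  \<open>rot a\<close> two pattern arcs with the same tail.\<close>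

lemma arev_not_in_pattern:
  assumes "a \<in> pattern_arcs"
  shows "arev a \<notin> pattern_arcs"
proof
  have a: "a \<in> arcs G"
    using assms pattern_subset_arcs by blast
  assume "arev a \<in> pattern_arcs"
  then have "rot a \<in> pattern_arcs"
    using next_in_pattern[of "arev a"] by simp
  then have "rot a = a"
    using pattern_unique[of "rot a" a] assms a by simp
  then show False
    using rot_neq(1) a by simp
qed

text \<open>A pattern face at the head of \<open>a\<close> carries the matched edge there. So if
  \<open>a\<close> and its successor were both not free, pattern faces would lie across both, which
  trivalence rules out.\<close>

lemma next_free:
  assumes "a \<in> arcs G" "a \<notin> free_arcs" "a \<notin> pattern_arcs" "rot (arev a) \<notin> pattern_arcs"
  shows "rot (arev a) \<in> free_arcs"
proof (rule ccontr)
  let ?b = "rot (arev a)"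
  have b: "?b \<in> arcs G" and tail_b: "tail G ?b = tail G (arev a)"
    using assms(1) by simp_all
  assume "?b \<notin> free_arcs"
  then have b_cases: "arev ?b \<in> pattern_arcs \<or> ?b \<in> matched_arcs"
    using assms(4) b by (simp add: free_arcs_def)
  have a_cases: "arev a \<in> pattern_arcs \<or> a \<in> matched_arcs"
    using assms by (simp add: free_arcs_def)
  \<comment> \<open>The pattern face that enters the vertex along \<open>arev ?b\<close> leaves it
    along \<open>rot ?b\<close>.\<close>
  have rot_b: "rot ?b \<in> pattern_arcs" if "arev ?b \<in> pattern_arcs"
    using next_in_pattern[OF that] by simp
  \<comment> \<open>Only one pattern arc leaves the vertex, so \<open>rot ?b\<close> would be
    \<open>arev a\<close> and the rotation would close after two steps.\<close>
  have "\<not> (arev a \<in> pattern_arcs \<and> arev ?b \<in> pattern_arcs)"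
  proof
    assume "arev a \<in> pattern_arcs \<and> arev ?b \<in> pattern_arcs"
    then have "rot ?b = arev a"
      using pattern_unique rot_b b tail_b by simp
    then show False
      using rot_neq(2)[of "arev a"] assms(1) by simp
  qed
  moreover have "arev ?b \<in> pattern_arcs" if "arev a \<in> pattern_arcs" "?b \<in> matched_arcs"
    using matched_at_pattern[OF that] tail_b assms(4) by simp
  moreover have "arev a \<in> pattern_arcs" if "arev ?b \<in> pattern_arcs" "a \<in> matched_arcs"
    using matched_at_pattern[OF rot_b[OF that(1)], of "arev a"] that(2) b tail_b assms(3)
    by (simp add: arev_matched)
  moreover have "\<not> (a \<in> matched_arcs \<and> ?b \<in> matched_arcs)"
    using next_not_matched by blast
  ultimately show False
    using a_cases b_cases by blast
qed

text \<open>The successor map sends the non-free arcs of \<open>f\<close> injectively to free ones,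
  so at least half of the five or six arcs are free.\<close>

lemma card_face_free:
  assumes "f \<in> faces G arev rot" "f \<notin> R"
  shows "card (f \<inter> free_arcs) \<ge> 3"
proof -
  have not_pattern: "a \<notin> pattern_arcs" if "a \<in> f" for a
    using that assms faces_disjoint R_faces by (auto simp: pattern_arcs_def)
  have "(\<lambda>a. rot (arev a)) ` (f - free_arcs) \<subseteq> f \<inter> free_arcs"
    using next_free not_pattern next_in_face[OF assms(1)] face_subset_arcs[OF assms(1)] by blast
  then have "card (f - free_arcs) \<le> card (f \<inter> free_arcs)"
    using card_inj_on_le inj_on_next_arc finite_face[OF assms(1)] by blast
  moreover have "card f = card (f \<inter> free_arcs) + card (f - free_arcs)"
    using finite_face[OF assms(1)] by (rule card_Int_Diff)
  ultimately show ?thesis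
    using card_face[OF assms(1)] by linarith
qed

section \<open>The number of free arcs\<close>

lemma card_pattern_Int:
  assumes "A \<subseteq> arcs G" "\<And>f. f \<in> R \<Longrightarrow> card (f \<inter> A) = k"
  shows "card (pattern_arcs \<inter> A) = k * card R"
proof -
  have "pattern_arcs \<inter> A = (\<Union>f\<in>R. f \<inter> A)"
    by (auto simp: pattern_arcs_def)
  also have "card \<dots> = (\<Sum>f\<in>R. card (f \<inter> A))"
  proof (rule card_UN_disjoint)
    show "finite R"
      using R_faces finite_faces by (rule finite_subset)
    show "\<forall>f\<in>R. finite (f \<inter> A)"
      using R_faces finite_face by blast
    show "\<forall>f\<in>R. \<forall>g\<in>R. f \<noteq> g \<longrightarrow> (f \<inter> A) \<inter> (g \<inter> A) = {}"
      using R_faces faces_disjoint by blast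
  qed
  also have "\<dots> = k * card R"
    using assms(2) by simp
  finally show ?thesis .
qed

text \<open>An arc lies on the pattern, is the reverse of such an arc, or neither;
  \<open>arev\<close> matches the first two kinds, which are disjoint. This serves for all arcs and
  for the matched arcs.\<close>

lemma card_split_pattern:
  assumes "A \<subseteq> arcs G" "arev ` A = A"
  shows "card A = 2 * card (pattern_arcs \<inter> A) +
    card {a \<in> A. a \<notin> pattern_arcs \<and> arev a \<notin> pattern_arcs}"
proof -
  let ?P = "pattern_arcs \<inter> A"
  let ?Q = "{a \<in> A. a \<notin> pattern_arcs \<and> arev a \<notin> pattern_arcs}"
  have fin: "finite A"
    using assms(1) finite_arcs by (rule finite_subset)
  have "arev a \<in> A" if "a \<in> A" for a
    using assms(2) that by blast
  then have "A = (?P \<union> arev ` ?P) \<union> ?Q"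
    by auto (metis IntI arev_arev image_eqI)
  also have "card \<dots> = card (?P \<union> arev ` ?P) + card ?Q"
    using fin by (intro card_Un_disjoint) auto
  also have "card (?P \<union> arev ` ?P) = card ?P + card (arev ` ?P)"
    using fin arev_not_in_pattern by (intro card_Un_disjoint) auto
  also have "card (arev ` ?P) = card ?P"
    by (simp add: card_image inj_on_arev)
  finally show ?thesis
    by simp
qed

text \<open>With \<open>V\<close> vertices and \<open>h\<close> pattern faces,
  \<open>3 * V - 12 * h\<close> arcs have their edge off the pattern, and \<open>V - 6 * h\<close>
  of these are matched; the rest are free.\<close>

lemma card_free_arcs: "card free_arcs + 6 * card R = 2 * card (verts G)"
proof -
  let ?Q = "{a \<in> arcs G. a \<notin> pattern_arcs \<and> arev a \<notin> pattern_arcs}"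
  let ?N = "{a \<in> matched_arcs. a \<notin> pattern_arcs \<and> arev a \<notin> pattern_arcs}"
  have "f \<inter> arcs G = f" if "f \<in> R" for f
    using that R_faces face_subset_arcs by blast
  then have "card (pattern_arcs \<inter> arcs G) = 6 * card R"
    using pattern_face by (intro card_pattern_Int) auto
  moreover have "arev ` arcs G = arcs G"
    using arev_permutes_arcs by (rule permutes_image)
  ultimately have Q: "3 * card (verts G) = 12 * card R + card ?Q"
    using card_split_pattern[of "arcs G"] card_arcs_eq_verts by simp
  have sub: "matched_arcs \<subseteq> arcs G"
    by (auto simp: matched_arcs_def)
  then have "card (pattern_arcs \<inter> matched_arcs) = 3 * card R"
    using pattern_face by (intro card_pattern_Int) auto
  moreover have "arev ` matched_arcs = matched_arcs"
    by (rule arev_image_eq) (simp add: arev_matched)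
  ultimately have N: "card (verts G) = 6 * card R + card ?N"
    using card_split_pattern[OF sub] card_matched_arcs by simp
  have "?Q = ?N \<union> free_arcs"
    using sub by (auto simp: free_arcs_def)
  moreover have "card (?N \<union> free_arcs) = card ?N + card free_arcs"
    using sub finite_arcs by (intro card_Un_disjoint) (auto simp: free_arcs_def intro: finite_subset)
  ultimately show ?thesis
    using Q N by simp
qed

section \<open>The face 2-colouring and the contradiction modulo 3\<close>

lemma unmatched_edges_even: "edges G arev - M \<in> even_sets"
proof -
  have "\<not> odd_at (edges G arev - M) v" if v: "v \<in> verts G" for v
  proof -
    obtain a where a: "a \<in> arcs G" "tail G a = v" "edge_of arev a \<in> M"
      using ex_matching_arc[OF v] by blast
    have "edge_of arev b \<in> edges G arev - M \<longleftrightarrow> b \<noteq> a" if "b \<in> out_arcs G v" for b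
      using matching_arc_unique[OF a(1), of b] that a(2,3) by (fastforce simp: edges_def)
    then have "{b \<in> out_arcs G v. edge_of arev b \<in> edges G arev - M} = out_arcs G v - {a}"
      by blast
    \<comment> \<open>Removing the matched arc from the three at \<open>v\<close> leaves
      two.\<close>
    then show ?thesis
      using trivalent[OF v] a by (simp add: odd_at_def out_degree_def)
  qed
  then show ?thesis
    by (auto simp: even_sets_def)
qed

text \<open>The sign is a face 2-colouring whose cut is the complement of \<open>M\<close>. Reversal
  permutes the free arcs and flips their signs, so the signed sum over them equals its own
  negative.\<close>

lemma ex_face_sign:
  obtains s :: "'e set \<Rightarrow> int" where "\<And>f. s f = 1 \<or> s f = -1"
    "(\<Sum>f\<in>faces G arev rot. s f * int (card (f \<inter> free_arcs))) = 0"
proof -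
  have "faces G arev rot \<noteq> {}"
    using card_faces by auto
  then obtain S where S: "separating_edges S = edges G arev - M"
    using even_set_is_separating unmatched_edges_even by blast
  define s :: "'e set \<Rightarrow> int" where "s f = (if f \<in> S then 1 else -1)" for f
  let ?s = "\<lambda>a. s (orbit (rot \<circ> arev) a)"
  have arev_free: "arev a \<in> free_arcs" if "a \<in> free_arcs" for a
    using that by (simp add: free_arcs_def arev_matched)
  have flip: "?s (arev a) = - ?s a" if "a \<in> free_arcs" for a
  proof -
    have "a \<in> arcs G" "edge_of arev a \<in> edges G arev - M"
      using that by (auto simp: free_arcs_def matched_arcs_def edges_def)
    then show ?thesis
      using edge_in_separating_edges[of a S] S by (auto simp: s_def)
  qed
  have "arev ` free_arcs = free_arcs"
    using arev_free by (rule arev_image_eq)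
  then have "sum ?s free_arcs = (\<Sum>a\<in>free_arcs. ?s (arev a))"
    using sum.reindex[OF inj_on_arev[of free_arcs], of ?s] by (simp add: comp_def)
  also have "\<dots> = - sum ?s free_arcs"
    using flip by (simp add: sum_negf)
  finally have "sum ?s free_arcs = 0"
    by simp
  moreover have "sum ?s free_arcs = (\<Sum>f\<in>faces G arev rot. sum ?s (f \<inter> free_arcs))"
    using sum_over_faces[of free_arcs ?s] by (simp add: free_arcs_def subset_iff)
  moreover have "sum ?s (f \<inter> free_arcs) = s f * int (card (f \<inter> free_arcs))"
    if "f \<in> faces G arev rot" for f
    using face_eq_orbit[OF that] by simp
  ultimately have "(\<Sum>f\<in>faces G arev rot. s f * int (card (f \<inter> free_arcs))) = 0"
    by simp
  then show ?thesis
    using that[of s] by (simp add: s_def)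
qed

theorem card_verts_neq: "card (verts G) \<noteq> 6 * card R + 14"
proof
  assume n: "card (verts G) = 6 * card R + 14"
  let ?N = "faces G arev rot - R"
  let ?t = "\<lambda>f. card (f \<inter> free_arcs)"
  \<comment> \<open>The excess over the minimum of three; by \<open>card_face_free\<close> the
    subtraction is exact on \<open>?N\<close>.\<close>
  define x where "x f = ?t f - 3" for f
  have fin: "finite ?N"
    using finite_faces by simp
  \<comment> \<open>With \<open>h = card R\<close>, Euler's formula gives \<open>3 * h + 9\<close>
    faces in all.\<close>
  have card_N: "card ?N = 2 * card R + 9"
    using card_Diff_subset[OF _ R_faces] finite_subset[OF R_faces finite_faces] card_faces n by simp
  have t: "?t f = x f + 3" if "f \<in> ?N" for f
    using card_face_free that by (simp add: x_def)
  have R_t: "?t f = 0" if "f \<in> R" for f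
  proof -
    have "f \<inter> free_arcs = {}"
      using that by (auto simp: free_arcs_def pattern_arcs_def)
    then show ?thesis
      by simp
  qed
  have restrict: "(\<Sum>f\<in>?N. h f) = (\<Sum>f\<in>faces G arev rot. h f)"
    if "\<And>f. f \<in> R \<Longrightarrow> h f = 0" for h :: "'e set \<Rightarrow> int"
    using R_faces that finite_faces by (intro sum.mono_neutral_left) auto
  have "(\<Sum>f\<in>?N. int (?t f)) = (\<Sum>f\<in>faces G arev rot. int (?t f))"
    using R_t by (intro restrict) simp
  also have "\<dots> = int (card free_arcs)"
    using sum_over_faces[of free_arcs "\<lambda>_. 1::int"] by (simp add: free_arcs_def subset_iff)
  finally have "(\<Sum>f\<in>?N. int (x f + 3)) = int (card free_arcs)"
    using t by simp
  \<comment> \<open>The total excess is \<open>(6 * h + 28) - 3 * (2 * h + 9)\<close>.\<close>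
  then have "int (sum x ?N) = 1"
    using card_free_arcs n card_N by (simp add: sum.distrib)
  then have "sum x ?N = 1"
    by linarith
  then obtain g where g: "g \<in> ?N" "x g = 1" "\<And>f. \<lbrakk>f \<in> ?N; g \<noteq> f\<rbrakk> \<Longrightarrow> x f = 0"
    using sum_eq_1_iff[OF fin, of x] by auto
  obtain s :: "'e set \<Rightarrow> int" where s: "\<And>f. s f = 1 \<or> s f = -1"
      "(\<Sum>f\<in>faces G arev rot. s f * int (?t f)) = 0"
    using ex_face_sign by blast
  \<comment> \<open>The signed sum becomes \<open>s g\<close> plus a multiple of 3, which cannot
    vanish for a sign \<open>s g\<close>.\<close>
  have "0 = (\<Sum>f\<in>?N. s f * int (?t f))"
    using s(2) R_t by (subst restrict) auto
  also have "\<dots> = (\<Sum>f\<in>?N. s f * int (x f) + 3 * s f)"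
    using t by (intro sum.cong) (auto simp: algebra_simps)
  also have "\<dots> = (\<Sum>f\<in>?N. s f * int (x f)) + 3 * sum s ?N"
    by (simp add: sum.distrib sum_distrib_left)
  also have "(\<Sum>f\<in>?N. s f * int (x f)) = (\<Sum>f\<in>?N. if f = g then s g else 0)"
    using g by (intro sum.cong) auto
  also have "\<dots> = s g"
    using g(1) fin by simp
  finally show False
    using s(1)[of g] by presburger
qed

end

section \<open>From the Clar number to a resonant pattern of that size\<close>

theorem theorem3p5:
  fixes G :: "('v, 'e) pre_digraph" and arev rot :: "'e \<Rightarrow> 'e" and n :: nat
  assumes "fullerene G arev rot"
    and "n = card (verts G)"
    and "n mod 6 = 2"
  shows "int (clar_number G arev rot) \<noteq> \<lfloor>real n / 6\<rfloor> - 2"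
proof
  interpret fullerene G arev rot
    by fact
  assume "int (clar_number G arev rot) = \<lfloor>real n / 6\<rfloor> - 2"
  then have clar: "int (clar_number G arev rot) = int (n div 6) - 2"
    using floor_divide_of_nat_eq[of n 6] by simp
  have "n \<ge> 20"
    using card_verts_ge assms(2) by simp
  let ?C = "{card R | R. resonant_pattern G arev rot R}"
  \<comment> \<open>Here \<open>n div 6 - 2\<close> is at least 1, whereas \<open>Sup\<close> of the
    empty set is 0. So resonant patterns exist and the maximum is attained.\<close>
  have "Sup ?C \<noteq> 0"
    using clar \<open>n \<ge> 20\<close> by (simp add: clar_number_def)
  then have "?C \<noteq> {}"
    by (metis Sup_nat_def)
  moreover have "finite ?C"
    by (rule finite_subset[of _ "card ` Pow (faces G arev rot)"])
      (auto simp: finite_faces resonant_pattern_def)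
  ultimately have "clar_number G arev rot \<in> ?C"
    unfolding clar_number_def Sup_nat_def using Max_in[of ?C] by (simp only: if_False simp_thms)
  then obtain R where R: "clar_number G arev rot = card R" "resonant_pattern G arev rot R"
    by (elim CollectE exE conjE)
  obtain M where M: "perfect_matching G arev M" "\<And>f. f \<in> R \<Longrightarrow> alternating arev M f"
    using R(2) unfolding resonant_pattern_def by blast
  have "R \<subseteq> faces G arev rot"
      "\<And>f g. \<lbrakk>f \<in> R; g \<in> R; f \<noteq> g\<rbrakk> \<Longrightarrow> face_verts G f \<inter> face_verts G g = {}"
    using R(2) unfolding resonant_pattern_def by blast+
  then interpret resonant_fullerene G arev rot R M
    using M by unfold_locales
  \<comment> \<open>Substitute \<open>n div 6 = card R + 2\<close> into
    \<open>n = 6 * (n div 6) + 2\<close>.\<close>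
  have "card (verts G) = 6 * card R + 14"
    using clar R(1) assms(2,3) mult_div_mod_eq[of 6 n] by linarith
  then show False
    using card_verts_neq by blast
qed

end
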